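(* Let $R:X\to\mathbb{R}\cup\{\infty\}$ be convex and satisfy (R1)--(R4) (listed in the context), and let $\alpha>0$, $\delta>0$. Then the functional $$J_\alpha^\delta(u)=\tfrac12\|Ku\|_Y^2-\langle Ku,f^\delta\rangle_{Z\times Z^*}+\alpha R(u),\qquad u\in X,$$ has a minimizer. Moreover, any such minimizer $u_\alpha^\delta$ satisfies $$R(u_\alpha^\delta)\le \frac{1+\gamma}{1-\gamma}R(u^\dagger)+\frac{\delta^2}{2\alpha(1-\gamma)}\|w\|_Y^2+\frac{2\gamma}{1-\gamma}R^\star\!\left(\frac{\delta}{\alpha\gamma}(K^*w-\eta)\right)$$ for any $\gamma\in(0,1)$ and any $w\in Y$, where $\eta=K^*n$.
   Context: $X$ is a separable Banach space and $Y$ a separable Hilbert space, identified with its dual. $(Z,Y,Z^* )$ is a Gelfand triple: $Z\subset Y$ is a dense subspace with Banach space structure, $Y=Y^*\subset Z^*$ is dense, and $\langle u,v\rangle_{Z\times Z^*}=\langle u,v\rangle_Y$ for $u\in Z$, $v\in Y$. $K:X\to Y$ is a continuous linear operator which is also continuous as a map $K:X\to Z$; consequently its adjoint extends to a continuous operator $K^*:Z^*\to X^*$. The noisy data are $f^\delta=Ku^\dagger+\delta n\in Z^*$ with $n\in Z^*$, where $u^\dagger\in X$ is a solution of $Ku=f$ that minimizes $R$ among all solutions. The convex conjugate is $R^\star(q)=\sup_{u\in X}(\langle q,u\rangle_{X^*\times X}-R(u))$, $q\in X^*$. The assumptions on $R$ are: (R1) $R$ is lower semicontinuous in some topology $\tau$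 on $X$; (R2) the sublevel sets $\{R\le\rho\}$ are sequentially compact in the topology $\tau$; (R3) $R^\star$ is finite on a ball in $X^*$ centered at zero; (R4) $R(-u)=R(u)$ for all $u\in X$. It is also assumed that $K:X\to Z$ is continuous with respect to the topology $\tau$ on $X$. *)

theory Defs
  imports "HOL-Analysis.Analysis"
begin

text \<open>
  A Gelfand triple $(Z, Y, Z^*)$ is given by the inclusion \<open>i\<close> of \<open>Z\<close> into the Hilbert space \<open>Y\<close>,
  with \<open>Z^*\<close> the type of bounded linear functionals on \<open>Z\<close>. The inclusion is bounded, since
  otherwise elements of \<open>Y\<close> would not act as continuous functionals on \<open>Z\<close>.
\<close>

definition dual_embed ::
  "('z::real_normed_vector \<Rightarrow>\<^sub>L 'y::real_inner) \<Rightarrow> 'y \<Rightarrow> ('z \<Rightarrow>\<^sub>L real)" where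
  "dual_embed i v = blinfun_inner_right v o\<^sub>L i"

lemma dual_embed_apply [simp]:
  "blinfun_apply (dual_embed i v) z = inner (blinfun_apply i z) v"
  by (simp add: dual_embed_def inner_commute)

definition gelfand_triple ::
  "('z::banach \<Rightarrow>\<^sub>L 'y::{real_inner, complete_space}) \<Rightarrow> bool" where
  "gelfand_triple i \<longleftrightarrow>
     inj (blinfun_apply i) \<and>
     closure (range (blinfun_apply i)) = UNIV \<and>
     closure (range (dual_embed i)) = UNIV"

definition banach_adjoint ::
  "('x::real_normed_vector \<Rightarrow>\<^sub>L 'z::real_normed_vector) \<Rightarrow> ('z \<Rightarrow>\<^sub>L real) \<Rightarrow> ('x \<Rightarrow>\<^sub>L real)" where
  "banach_adjoint T \<phi> = \<phi> o\<^sub>L T"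

text \<open>
  If \<open>T\<close> is a bounded map into \<open>Z\<close> and \<open>i o\<^sub>L T\<close> is the same map regarded as a map into \<open>Y\<close>, then
  the adjoint of \<open>T\<close>, defined on $Z^*$, extends the adjoint of \<open>i o\<^sub>L T\<close>, defined on $Y = Y^*$.
\<close>

lemma banach_adjoint_dual_embed:
  "banach_adjoint T (dual_embed i v) = banach_adjoint (i o\<^sub>L T) (blinfun_inner_right v)"
  by (rule blinfun_eqI) (simp add: banach_adjoint_def inner_commute)

definition ereal_convex :: "('x::real_vector \<Rightarrow> ereal) \<Rightarrow> bool" where
  "ereal_convex R \<longleftrightarrow>
     (\<forall>u v. \<forall>t\<in>{0..1}. R ((1 - t) *\<^sub>R u + t *\<^sub>R v) \<le> ereal (1 - t) * R u + ereal t * R v)"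

definition convex_conjugate ::
  "('x::real_normed_vector \<Rightarrow> ereal) \<Rightarrow> ('x \<Rightarrow>\<^sub>L real) \<Rightarrow> ereal" where
  "convex_conjugate R q = (SUP u. ereal (blinfun_apply q u) - R u)"

definition lsc_in :: "'a topology \<Rightarrow> ('a \<Rightarrow> ereal) \<Rightarrow> bool" where
  "lsc_in \<tau> R \<longleftrightarrow> (\<forall>a. openin \<tau> {u \<in> topspace \<tau>. a < R u})"

definition seq_compactin :: "'a topology \<Rightarrow> 'a set \<Rightarrow> bool" where
  "seq_compactin \<tau> S \<longleftrightarrow> S \<subseteq> topspace \<tau> \<and>
     (\<forall>s :: nat \<Rightarrow> 'a. range s \<subseteq> S \<longrightarrow>
        (\<exists>l\<in>S. \<exists>r :: nat \<Rightarrow> nat. strict_mono r \<and> limitin \<tau> (s \<circ> r) l sequentially))"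

text \<open>
  \<open>K\<close> and \<open>KZ\<close> are the same operator regarded as a map into \<open>Y\<close> and into \<open>Z\<close>, respectively.
\<close>

definition tikhonov ::
  "('x::real_normed_vector \<Rightarrow>\<^sub>L 'y::real_inner) \<Rightarrow> ('x \<Rightarrow>\<^sub>L 'z::real_normed_vector) \<Rightarrow>
   ('x \<Rightarrow> ereal) \<Rightarrow> real \<Rightarrow> ('z \<Rightarrow>\<^sub>L real) \<Rightarrow> 'x \<Rightarrow> ereal" where
  "tikhonov K KZ R \<alpha> g u =
     ereal ((1/2) * (norm (blinfun_apply K u))\<^sup>2 - blinfun_apply g (blinfun_apply KZ u))
       + ereal \<alpha> * R u"

end

theory Submission
  imports Defs
begin

text \<open>
  Write \<open>q = (\<delta> / (\<alpha> \<gamma>)) (K\<^sup>* w - \<eta>)\<close> for the rescaled error made when the functional \<open>\<eta> = K\<^sup>* n\<close> is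
  replaced by \<open>K\<^sup>* w\<close> with \<open>w \<in> Y\<close>. The noise \<open>n\<close> acts only on \<open>Z\<close>, so the data term cannot be
  completed to a square in \<open>Y\<close>; but \<open>w\<close> does lie in \<open>Y\<close>, and completing the square with
  \<open>K u\<^sup>\<dagger> + \<delta> w\<close> as data leaves precisely the linear term \<open>\<alpha> \<gamma> q(u)\<close>
  (lemma \<open>data_term_complete_square\<close>). The penalty \<open>\<alpha> R\<close> can pay for that term: by Fenchel's
  inequality and evenness of \<open>R\<close>, \<open>\<bar>q(u)\<bar> \<le> R(u) + R\<^sup>\<star>(q)\<close>, so for \<open>\<gamma> < 1\<close> only a fraction of the
  penalty is used up.

  Both claims follow. For existence, \<open>Y\<close> is dense in \<open>Z\<^sup>*\<close>, so with \<open>\<gamma> = 1/2\<close> some \<open>w\<close> makes \<open>q\<close> so small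
  that \<open>R\<^sup>\<star>(q)\<close> is finite. Then the remaining half of the penalty is bounded on sublevel sets of the
  functional, and the direct method applies: sublevel sets of \<open>R\<close> are sequentially compact, the data
  term is continuous and \<open>R\<close> is lower semicontinuous. For the estimate, compare the minimizer with
  \<open>u\<^sup>\<dagger>\<close>: the constants from the completed square cancel, the square at \<open>u\<^sup>\<dagger>\<close> is \<open>(\<delta>\<^sup>2/2) \<parallel>w\<parallel>\<^sup>2\<close>, and
  Fenchel's inequality, used once at each point, turns the linear terms into the factors
  \<open>1 - \<gamma>\<close>, \<open>1 + \<gamma>\<close> and \<open>2 \<gamma>\<close>.
\<close>

lemma fenchel_young_even:
  assumes even: "R (- u) = R u" and u: "R u = ereal a" and q: "convex_conjugate R q = ereal c"
  shows "\<bar>blinfun_apply q u\<bar> \<le> a + c"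
proof -
  have "ereal (blinfun_apply q v) - R v \<le> convex_conjugate R q" for v
    unfolding convex_conjugate_def by (rule SUP_upper) simp
  from this[of u] this[of "- u"] show ?thesis
    by (simp add: even u q blinfun.minus_right)
qed

lemma convex_conjugate_not_MInfty:
  assumes "R u = ereal a"
  shows "convex_conjugate R q \<noteq> -\<infinity>"
proof -
  have "ereal (blinfun_apply q u) - R u \<le> convex_conjugate R q"
    unfolding convex_conjugate_def by (rule SUP_upper) simp
  with assms show ?thesis by auto
qed

lemma lsc_in_le_limit:
  assumes lsc: "lsc_in \<tau> R" and lim: "limitin \<tau> s l sequentially"
    and L: "(\<lambda>k. R (s k)) \<longlonglongrightarrow> L"
  shows "R l \<le> L"
proof (rule dense_le)
  fix a assume a: "a < R l"
  have "openin \<tau> {u \<in> topspace \<tau>. a < R u}" using lsc by (simp add: lsc_in_def)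
  with lim a have "\<forall>\<^sub>F k in sequentially. s k \<in> {u \<in> topspace \<tau>. a < R u}"
    unfolding limitin_def by blast
  then have "\<forall>\<^sub>F k in sequentially. a \<le> R (s k)" by (rule eventually_mono) auto
  with L show "a \<le> L" by (intro tendsto_lowerbound) auto
qed

text \<open>
  The direct method for a functional whose sublevel sets need not be compact themselves: it is enough
  that they lie in sublevel sets of the penalty. Along a \<open>\<tau>\<close>-convergent minimizing sequence the
  continuous term has a real limit, hence the penalty converges too, and lower semicontinuity bounds
  the penalty at the limit point.
\<close>

lemma direct_method_penalized:
  fixes g :: "'a \<Rightarrow> real" and R :: "'a \<Rightarrow> ereal"
  assumes g: "continuous_map \<tau> euclideanreal g"
    and lsc: "lsc_in \<tau> R"
    and compact: "\<And>\<rho>::real. seq_compactin \<tau> {u. R u \<le> ereal \<rho>}"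
    and coercive: "\<And>M::real. \<exists>\<rho>::real. \<forall>u. ereal (g u) + ereal \<alpha> * R u \<le> ereal M \<longrightarrow> R u \<le> ereal \<rho>"
    and \<alpha>: "\<alpha> > 0"
  shows "\<exists>u. \<forall>v. ereal (g u) + ereal \<alpha> * R u \<le> ereal (g v) + ereal \<alpha> * R v"
proof -
  define J where "J u = ereal (g u) + ereal \<alpha> * R u" for u
  define m where "m = (INF u. J u)"
  have "\<exists>u. J u \<le> m"
  proof (cases "m = \<infinity>")
    case False
    obtain t where t: "range t \<subseteq> range J" "decseq t" "m = (INF k. t k)"
      using Inf_countable_INF[of "range J"] unfolding m_def by auto
    have "\<forall>k. \<exists>u. t k = J u" using t(1) by blast
    then obtain s where s: "\<And>k. t k = J (s k)" by metis
    have Js: "(\<lambda>k. J (s k)) \<longlonglongrightarrow> m"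
      using LIMSEQ_INF[OF t(2)] unfolding t(3)[symmetric] by (simp flip: s)
    from False obtain M :: real where M: "m < ereal M"
      using less_PInf_Ex_of_nat by (auto simp: less_top)
    then have "\<forall>\<^sub>F k in sequentially. J (s k) < ereal M"
      using Js order_tendstoD(2) by blast
    then obtain N where N: "\<And>k. k \<ge> N \<Longrightarrow> J (s k) < ereal M"
      by (auto simp: eventually_sequentially)
    obtain \<rho> :: real where \<rho>: "\<And>u. J u \<le> ereal M \<Longrightarrow> R u \<le> ereal \<rho>"
      using coercive[of M] unfolding J_def by blast
    have "range (\<lambda>k. s (k + N)) \<subseteq> {u. R u \<le> ereal \<rho>}"
      using \<rho>[OF less_imp_le[OF N]] by auto
    then obtain l r where r: "strict_mono r" "limitin \<tau> ((\<lambda>k. s (k + N)) \<circ> r) l sequentially"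
      using compact[of \<rho>] unfolding seq_compactin_def by blast
    define p where "p k = s (r k + N)" for k
    have p: "limitin \<tau> p l sequentially" using r(2) by (simp add: p_def[abs_def] o_def)
    have Jp: "(\<lambda>k. J (p k)) \<longlonglongrightarrow> m"
      using LIMSEQ_subseq_LIMSEQ[OF LIMSEQ_ignore_initial_segment[OF Js, of N] r(1)]
      by (simp add: p_def o_def)
    have gp: "(\<lambda>k. g (p k)) \<longlonglongrightarrow> g l"
      using continuous_map_limit[OF g p] by (simp add: o_def)
    \<comment> \<open>The penalty is recovered from \<open>J\<close> because \<open>g\<close> is real-valued, so it inherits a limit from \<open>J\<close>.\<close>
    have R_eq: "R u = ereal (1 / \<alpha>) * (J u - ereal (g u))" for u
      using \<alpha> by (cases "R u") (auto simp: J_def)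
    have "(\<lambda>k. ereal (1 / \<alpha>) * (J (p k) - ereal (g (p k)))) \<longlonglongrightarrow> ereal (1 / \<alpha>) * (m - ereal (g l))"
      using Jp gp by (intro tendsto_cmult_ereal tendsto_diff_ereal_general) auto
    then have "R l \<le> ereal (1 / \<alpha>) * (m - ereal (g l))"
      using lsc_in_le_limit[OF lsc p] by (simp flip: R_eq)
    then have "J l \<le> m"
      using \<alpha> by (cases "R l"; cases m) (auto simp: J_def field_simps)
    then show ?thesis ..
  qed auto
  then obtain u where "J u \<le> m" ..
  then have "J u \<le> J v" for v
    unfolding m_def by (rule order_trans) (simp add: INF_lower)
  then show ?thesis unfolding J_def by blast
qed

text \<open>
  With \<open>w \<in> Y\<close> in place of \<open>n\<close> the left-hand side is a square up to a constant, and the error of this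
  replacement is \<open>\<delta> (K\<^sup>* w - K\<^sup>* n)(u)\<close>. Splitting off a factor \<open>c\<close> here makes Fenchel's inequality
  cost \<open>c\<close> times the penalty, so that \<open>c = \<alpha> \<gamma>\<close> consumes the fraction \<open>\<gamma>\<close> of \<open>\<alpha> R\<close>.
\<close>

lemma data_term_complete_square:
  fixes i :: "'z::real_normed_vector \<Rightarrow>\<^sub>L 'y::real_inner"
    and KZ :: "'x::real_normed_vector \<Rightarrow>\<^sub>L 'z"
  assumes K: "\<And>u. blinfun_apply i (blinfun_apply KZ u) = blinfun_apply K u"
    and c: "c \<noteq> 0"
  shows "(1/2) * (norm (blinfun_apply K u))\<^sup>2
      - blinfun_apply (dual_embed i y + \<delta> *\<^sub>R n) (blinfun_apply KZ u)
    = (1/2) * (norm (blinfun_apply K u - (y + \<delta> *\<^sub>R w)))\<^sup>2 - (1/2) * (norm (y + \<delta> *\<^sub>R w))\<^sup>2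
      + c * blinfun_apply ((\<delta> / c) *\<^sub>R (banach_adjoint KZ (dual_embed i w) - banach_adjoint KZ n)) u"
  using c unfolding power2_norm_eq_inner
  by (simp add: K banach_adjoint_def blinfun.bilinear_simps inner_simps inner_commute algebra_simps)

lemma gelfand_triple_adjoint_dense:
  assumes "gelfand_triple i" and "\<epsilon> > 0"
  obtains w where "norm (banach_adjoint T (dual_embed i w) - banach_adjoint T n) < \<epsilon>"
proof -
  have "n \<in> closure (range (dual_embed i))" using assms(1) by (simp add: gelfand_triple_def)
  moreover have "\<epsilon> / (norm T + 1) > 0" using assms(2) by (simp add: add_nonneg_pos)
  ultimately obtain w where w: "dist (dual_embed i w) n < \<epsilon> / (norm T + 1)"
    unfolding closure_approachable by blast
  have "norm (banach_adjoint T (dual_embed i w) - banach_adjoint T n)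
      = norm ((dual_embed i w - n) o\<^sub>L T)"
    by (rule arg_cong[where f = norm], rule blinfun_eqI)
      (simp add: banach_adjoint_def blinfun.bilinear_simps)
  also have "\<dots> \<le> norm (dual_embed i w - n) * norm T" by (rule norm_blinfun_compose)
  also have "\<dots> \<le> norm (dual_embed i w - n) * (norm T + 1)" by (intro mult_left_mono) auto
  also have "\<dots> < \<epsilon>" using w by (simp add: dist_norm pos_less_divide_eq add_nonneg_pos)
  finally show ?thesis by (rule that)
qed

theorem proposition2p1:
  fixes i :: "'z::banach \<Rightarrow>\<^sub>L 'y::{real_inner, complete_space}"
    and K :: "'x::banach \<Rightarrow>\<^sub>L 'y"
    and KZ :: "'x \<Rightarrow>\<^sub>L 'z"
    and \<tau> :: "'x topology"
    and R :: "'x \<Rightarrow> ereal"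
    and f :: 'y
    and u_dag :: 'x
    and n f\<delta> :: "'z \<Rightarrow>\<^sub>L real"
    and \<eta> :: "'x \<Rightarrow>\<^sub>L real"
    and \<alpha> \<delta> :: real
  assumes "separable_space (euclidean :: 'x topology)"
    and "separable_space (euclidean :: 'y topology)"
    and "gelfand_triple i"
    and "\<And>u. blinfun_apply i (blinfun_apply KZ u) = blinfun_apply K u"
    and "topspace \<tau> = UNIV"
    and "continuous_map \<tau> euclidean (blinfun_apply KZ)"
    and "\<And>u. R u \<noteq> -\<infinity>"
    and "ereal_convex R"
    and R1: "lsc_in \<tau> R"
    and R2: "\<And>\<rho>::real. seq_compactin \<tau> {u. R u \<le> ereal \<rho>}"
    and R3: "\<exists>r>0. \<forall>q\<in>ball 0 r. \<bar>convex_conjugate R q\<bar> \<noteq> \<infinity>"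
    and R4: "\<And>u. R (- u) = R u"
    and "is_arg_min R (\<lambda>u. blinfun_apply K u = f) u_dag"
    and "f\<delta> = dual_embed i (blinfun_apply K u_dag) + \<delta> *\<^sub>R n"
    and "\<eta> = banach_adjoint KZ n"
    and "\<alpha> > 0"
    and "\<delta> > 0"
  shows "(\<exists>u. is_arg_min (tikhonov K KZ R \<alpha> f\<delta>) (\<lambda>_. True) u) \<and>
    (\<forall>u. is_arg_min (tikhonov K KZ R \<alpha> f\<delta>) (\<lambda>_. True) u \<longrightarrow>
      (\<forall>\<gamma>\<in>{0<..<1}. \<forall>w.
         R u \<le> ereal ((1 + \<gamma>) / (1 - \<gamma>)) * R u_dag
             + ereal (\<delta>\<^sup>2 / (2 * \<alpha> * (1 - \<gamma>)) * (norm w)\<^sup>2)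
             + ereal (2 * \<gamma> / (1 - \<gamma>)) *
               convex_conjugate R ((\<delta> / (\<alpha> * \<gamma>)) *\<^sub>R (banach_adjoint KZ (dual_embed i w) - \<eta>))))"
proof -
  define g where "g u = (1/2) * (norm (blinfun_apply K u))\<^sup>2 - blinfun_apply f\<delta> (blinfun_apply KZ u)" for u
  define Q where "Q \<gamma> w = (\<delta> / (\<alpha> * \<gamma>)) *\<^sub>R (banach_adjoint KZ (dual_embed i w) - \<eta>)" for \<gamma> w
  define y where "y w = blinfun_apply K u_dag + \<delta> *\<^sub>R w" for w
  note K = assms(4) and pos = \<open>\<alpha> > 0\<close> \<open>\<delta> > 0\<close>
  have J: "tikhonov K KZ R \<alpha> f\<delta> u = ereal (g u) + ereal \<alpha> * R u" for u
    by (simp add: tikhonov_def g_def)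
  have square: "g u = (1/2) * (norm (blinfun_apply K u - y w))\<^sup>2 - (1/2) * (norm (y w))\<^sup>2
      + \<alpha> * \<gamma> * blinfun_apply (Q \<gamma> w) u" if "\<gamma> > 0" for \<gamma> w u
    unfolding g_def Q_def y_def assms(14,15)
    by (rule data_term_complete_square[OF K]) (use pos that in auto)

  have g_cont: "continuous_map \<tau> euclideanreal g"
  proof -
    have "continuous_on UNIV (\<lambda>z. (1/2) * (norm (blinfun_apply i z))\<^sup>2 - blinfun_apply f\<delta> z)"
      by (intro continuous_intros)
    then have "continuous_map \<tau> euclideanreal
        ((\<lambda>z. (1/2) * (norm (blinfun_apply i z))\<^sup>2 - blinfun_apply f\<delta> z) \<circ> blinfun_apply KZ)"
      by (intro continuous_map_compose[OF assms(6)]) simp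
    then show ?thesis by (simp add: o_def K g_def[abs_def])
  qed
  have coercive: "\<exists>\<rho>::real. \<forall>u. ereal (g u) + ereal \<alpha> * R u \<le> ereal M \<longrightarrow> R u \<le> ereal \<rho>" for M :: real
  proof -
    obtain r where r: "r > 0" "\<And>q. norm q < r \<Longrightarrow> \<bar>convex_conjugate R q\<bar> \<noteq> \<infinity>"
      using R3 by auto
    obtain w where "norm (banach_adjoint KZ (dual_embed i w) - \<eta>) < r * \<alpha> / (2 * \<delta>)"
      using gelfand_triple_adjoint_dense[OF assms(3), of "r * \<alpha> / (2 * \<delta>)" KZ n] r(1) pos
      by (auto simp: assms(15))
    then have "norm (Q (1/2) w) < r"
      using pos unfolding Q_def norm_scaleR by (simp add: field_simps)
    then obtain c where c: "convex_conjugate R (Q (1/2) w) = ereal c"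
      using r(2) by (metis ereal_infinity_cases abs_ereal.simps(2,3) ereal_cases)
    \<comment> \<open>The value is what remains after dropping the square in \<open>g u\<close> and solving for \<open>R u\<close>.\<close>
    have "R u \<le> ereal ((2 * M + (norm (y w))\<^sup>2) / \<alpha> + c)"
      if le: "ereal (g u) + ereal \<alpha> * R u \<le> ereal M" for u
    proof (cases "R u")
      case (real a)
      have "\<alpha> * \<bar>blinfun_apply (Q (1/2) w) u\<bar> \<le> \<alpha> * (a + c)"
        using fenchel_young_even[OF R4 real c] pos by simp
      then have "- (\<alpha> * blinfun_apply (Q (1/2) w) u) \<le> \<alpha> * (a + c)"
        using pos by (smt (verit) mult_left_mono mult_minus_right)
      moreover have "g u + \<alpha> * a \<le> M" using le real by simp
      ultimately have "\<alpha> * a \<le> 2 * M + (norm (y w))\<^sup>2 + \<alpha> * c"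
        using square[of "1/2" u w] zero_le_power2[of "norm (blinfun_apply K u - y w)"]
        unfolding distrib_left by linarith
      then show ?thesis using pos real by (simp add: field_simps)
    qed (use le pos in auto)
    then show ?thesis by blast
  qed
  have "\<exists>u. is_arg_min (tikhonov K KZ R \<alpha> f\<delta>) (\<lambda>_. True) u"
    using direct_method_penalized[OF g_cont R1 R2 coercive \<open>\<alpha> > 0\<close>]
    by (simp add: is_arg_min_linorder J)
  moreover have "R u \<le> ereal ((1 + \<gamma>) / (1 - \<gamma>)) * R u_dag
             + ereal (\<delta>\<^sup>2 / (2 * \<alpha> * (1 - \<gamma>)) * (norm w)\<^sup>2)
             + ereal (2 * \<gamma> / (1 - \<gamma>)) * convex_conjugate R (Q \<gamma> w)"
    if min: "is_arg_min (tikhonov K KZ R \<alpha> f\<delta>) (\<lambda>_. True) u" and \<gamma>: "\<gamma> \<in> {0<..<1}" for u \<gamma> w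
  proof -
    have \<gamma>: "0 < \<gamma>" "\<gamma> < 1" using \<gamma> by auto
    show ?thesis
    proof (cases "R u_dag")
      case PInf
      then show ?thesis using \<gamma> by simp
    next
      case MInf
      then show ?thesis using assms(7) by blast
    next
      case (real d)
      show ?thesis
      proof (cases "convex_conjugate R (Q \<gamma> w)")
        case PInf
        then show ?thesis using \<gamma> real by simp
      next
        case MInf
        then show ?thesis using convex_conjugate_not_MInfty[of R, OF real] by blast
      next
        case c: (real c)
        have le: "ereal (g u) + ereal \<alpha> * R u \<le> ereal (g u_dag) + ereal \<alpha> * ereal d"
          using min unfolding is_arg_min_linorder J real[symmetric] by blast
        then obtain a where a: "R u = ereal a"
          using pos assms(7)[of u] by (cases "R u") auto
        let ?q = "blinfun_apply (Q \<gamma> w)"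
        have "(1/2) * (norm (blinfun_apply K u - y w))\<^sup>2 + \<alpha> * \<gamma> * ?q u + \<alpha> * a
            \<le> (1/2) * (norm (blinfun_apply K u_dag - y w))\<^sup>2 + \<alpha> * \<gamma> * ?q u_dag + \<alpha> * d"
          using le a square[OF \<gamma>(1), of u w] square[OF \<gamma>(1), of u_dag w] by simp
        moreover have "(norm (blinfun_apply K u_dag - y w))\<^sup>2 = \<delta>\<^sup>2 * (norm w)\<^sup>2"
          by (simp add: y_def power_mult_distrib)
        ultimately have "\<alpha> * a \<le> \<delta>\<^sup>2 * (norm w)\<^sup>2 / 2 + \<alpha> * \<gamma> * (?q u_dag - ?q u) + \<alpha> * d"
          using zero_le_power2[of "norm (blinfun_apply K u - y w)"]
          unfolding right_diff_distrib by linarith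
        also have "\<alpha> * \<gamma> * (?q u_dag - ?q u) \<le> \<alpha> * \<gamma> * ((d + c) + (a + c))"
          using fenchel_young_even[OF R4 real c] fenchel_young_even[OF R4 a c] pos \<gamma>
          by (intro mult_left_mono) auto
        finally have "a * (1 - \<gamma>) * \<alpha> \<le> ((1 + \<gamma>) * d + 2 * \<gamma> * c) * \<alpha> + \<delta>\<^sup>2 * (norm w)\<^sup>2 / 2"
          by (simp add: algebra_simps)
        then have "a \<le> (((1 + \<gamma>) * d + 2 * \<gamma> * c) * \<alpha> + \<delta>\<^sup>2 * (norm w)\<^sup>2 / 2) / ((1 - \<gamma>) * \<alpha>)"
          using \<gamma> pos by (simp add: pos_le_divide_eq mult.assoc)
        also have "\<dots> = (1 + \<gamma>) / (1 - \<gamma>) * d + \<delta>\<^sup>2 / (2 * \<alpha> * (1 - \<gamma>)) * (norm w)\<^sup>2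
            + 2 * \<gamma> / (1 - \<gamma>) * c"
          using \<gamma> pos by (simp add: divide_simps) (simp add: algebra_simps)
        finally show ?thesis using real a c by simp
      qed
    qed
  qed
  ultimately show ?thesis unfolding Q_def by blast
qed

end
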